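(* Let $g$ be the moment matrix built from matrix weights $\rho_j$ ($j\ge 0$) satisfying the periodicity condition $\rho_{j+m_b,ab}(x)=x^{n_a}\rho_{j,ab}(x)$, so that $g$ has the multigraded-Hankel symmetry $\Lambda^{\vec n}g=g(\Lambda^{\top})^{\vec m}$. Then for every integer $l\ge 1$ with $l\ge\max\{|\vec n|,|\vec m|\}$ and all $x,y\in\mathbb{R}$ the following Christoffel--Darboux formula holds: $$ x^{\vec n}K^{[l]}(x,y)-K^{[l]}(x,y)\,y^{\vec n}=\sum_{a=1}^{N}\Big(\sum_{j=0}^{m_a-1}\tilde p_{l,+j}(x)^{\top}E_{aa}\,p_{l-1,-(m_a-j-1)}(y)-\sum_{j=0}^{n_a-1}\tilde p_{l-1,-(n_a-j-1)}(x)^{\top}E_{aa}\,p_{l,+j}(y)\Big). $$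
   Context: Fix $N\ge 1$ and multi-indices $\vec n=(n_1,\dots,n_N)$, $\vec m=(m_1,\dots,m_N)$ of non-negative integers; $|\vec n|=\sum_a n_a$, $|\vec m|=\sum_a m_a$. $\mathbb{I}_N$ is the $N\times N$ identity matrix and $E_{aa}$ is the $N\times N$ matrix whose only nonzero entry is a $1$ at position $(a,a)$. For a real number $x$, $x^{\vec n}=\sum_a x^{n_a}E_{aa}=\mathrm{diag}(x^{n_1},\dots,x^{n_N})$. All semi-infinite vectors and matrices are partitioned into $N\times N$ blocks indexed by $0,1,2,\dots$. The shift is $\Lambda_{ij}=\mathbb{I}_N\delta_{i,j-1}$. The power $\Lambda^{\vec n}=\sum_{a=1}^N\Lambda^{n_a}E_{aa}$ has blocks $(\Lambda^{\vec n})_{ij}=\sum_a\delta_{i+n_a,j}E_{aa}$, and $(\Lambda^\top)^{\vec m}=\sum_a(\Lambda^\top)^{m_a}E_{aa}=(\Lambda^{\vec m})^\top$. Weights and moment matrix. $\rho_j:\mathbb{R}\to\mathbb{C}^{N\times N}$, $j\ge0$, are matrix weights $\rho_j=(\rho_{j,ab})_{1\le a,b\le N}$ with all moments $\int_{\mathbb{R}}x^i\rho_j(x)\,dx$ finite, satisfying $\rho_{j+m_b,ab}(x)=x^{n_a}\rho_{j,ab}(x)$ for all $j\ge0$ and all $a,b$. Let $\chi_1(x)$ be the block column with blocks $\chi_1^{(i)}(x)=x^i\mathbb{I}_N$, and let $\chi_2(x)$ be the block column such that $\chi_2(x)^\top$ is the block row $(\rho_0(x),\rho_1(x),\dots)$,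 i.e. $\chi_2^{(j)}(x)^\top=\rho_j(x)$. The moment matrix is $g=\int_{\mathbb{R}}\chi_1(x)\chi_2(x)^\top dx$, with blocks $g_{ij}=\int_{\mathbb{R}}x^i\rho_j(x)\,dx$; it satisfies $\Lambda^{\vec n}g=g(\Lambda^\top)^{\vec m}$. Factorization. It is assumed that $g=S^{-1}\tilde S$ with $S$ block lower triangular having $\mathbb{I}_N$ in its diagonal blocks and $\tilde S$ block upper triangular with invertible diagonal blocks. Hence every truncation $g^{[l]}$ is invertible, where $g^{[l]}$ consists of the blocks $g_{ij}$ with $0\le i,j\le l-1$. For a block vector $v$, $v^{[l]}$ is the vector of its first $l$ blocks. (Generalized) polynomials and kernel. $p(x)=S\chi_1(x)$ and $\tilde p(x)=(\tilde S^{-1})^\top\chi_2(x)$, with blocks $p_k$, $\tilde p_k$. For $l\ge1$, $$K^{[l]}(x,y)=\sum_{k=0}^{l-1}\tilde p_k(x)^\top p_k(y).$$ Associated (generalized) polynomials. $e_i$ denotes the block column (with the number of blocks dictated by the context) with $\mathbb{I}_N$ in position $i$ (positions start at $0$) and zero blocks elsewhere. For $j\ge0$, $$p_{l,+j}(x)=\chi_1^{(l+j)}(x)-\begin{pmatrix}g_{l+j,0}&\cdots&g_{l+j,l-1}\end{pmatrix}(g^{[l]})^{-1}\chi_1^{[l]}(x),$$ $$\tilde p_{l,+j}(x)^\top=\chi_2^{(l+j)}(x)^\top-\chi_2^{[l]}(x)^\top(g^{[l]})^{-1}C_{l,j},$$ where $C_{l,j}$ is the block column with blocks $g_{0,l+j},g_{1,l+j},\dots,g_{l-1,l+j}$.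 For $0\le j\le l$, $$p_{l,-j}(x)=e_{l-j}^\top(g^{[l+1]})^{-1}\chi_1^{[l+1]}(x),\qquad \tilde p_{l,-j}(x)^\top=\chi_2^{[l+1]}(x)^\top(g^{[l+1]})^{-1}e_{l-j}.$$ *)

theory Defs
  imports "HOL-Analysis.Analysis" "HOL-Library.Groups_Big_Fun"
begin

text \<open>The index type \<open>'N\<close> (finite, hence of some cardinality at least 1) plays the role of
  \<open>{1,...,N}\<close>; blocks are indexed by \<open>nat\<close>.\<close>

type_synonym 'N blk = "complex^'N^'N"
type_synonym 'N block_vec = "nat \<Rightarrow> 'N blk"
type_synonym 'N block_mat = "nat \<Rightarrow> nat \<Rightarrow> 'N blk"

definition E :: "'N::finite \<Rightarrow> 'N blk" where
  "E a = axis a (axis a 1)"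

definition multi_pow :: "real \<Rightarrow> ('N::finite \<Rightarrow> nat) \<Rightarrow> 'N blk" where
  "multi_pow x n = (\<Sum>a\<in>UNIV. (x ^ n a) *\<^sub>R E a)"


subsection \<open>Semi-infinite block matrices\<close>

text \<open>\<open>Sum_any f\<close> is the sum of \<open>f\<close> over its support, provided the support is finite. This is
  the case for all products below, since at least one factor is triangular (or truncated) on the
  appropriate side.\<close>

definition block_mult :: "'N::finite block_mat \<Rightarrow> 'N block_mat \<Rightarrow> 'N block_mat" where
  "block_mult A B = (\<lambda>i j. Sum_any (\<lambda>k. A i k ** B k j))"

definition block_mult_vec :: "'N::finite block_mat \<Rightarrow> 'N block_vec \<Rightarrow> 'N block_vec" where
  "block_mult_vec A v = (\<lambda>i. Sum_any (\<lambda>k. A i k ** v k))"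

definition block_transpose :: "'N::finite block_mat \<Rightarrow> 'N block_mat" where
  "block_transpose A = (\<lambda>i j. transpose (A j i))"

definition block_id :: "'N::finite block_mat" where
  "block_id = (\<lambda>i j. if i = j then mat 1 else 0)"

definition block_lower :: "'N::finite block_mat \<Rightarrow> bool" where
  "block_lower A \<longleftrightarrow> (\<forall>i j. i < j \<longrightarrow> A i j = 0)"

definition block_upper :: "'N::finite block_mat \<Rightarrow> bool" where
  "block_upper A \<longleftrightarrow> (\<forall>i j. j < i \<longrightarrow> A i j = 0)"

text \<open>The product of semi-infinite matrices is not associative in general, so inverses are taken
  inside the algebra of block lower (resp. upper) triangular matrices, where they are unique.\<close>

definition lower_inv :: "'N::finite block_mat \<Rightarrow> 'N block_mat" where
  "lower_inv A =
     (THE B. block_lower B \<and> block_mult A B = block_id \<and> block_mult B A = block_id)"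

definition upper_inv :: "'N::finite block_mat \<Rightarrow> 'N block_mat" where
  "upper_inv A =
     (THE B. block_upper B \<and> block_mult A B = block_id \<and> block_mult B A = block_id)"

text \<open>The truncation of \<open>A\<close> to its blocks with indices below \<open>l\<close> is represented by padding with
  zero blocks; its inverse is the inverse of the finite block matrix, padded in the same way.\<close>

definition trunc :: "nat \<Rightarrow> 'N::finite block_mat \<Rightarrow> 'N block_mat" where
  "trunc l A = (\<lambda>i j. if i < l \<and> j < l then A i j else 0)"

definition trunc_inv :: "nat \<Rightarrow> 'N::finite block_mat \<Rightarrow> 'N block_mat" where
  "trunc_inv l A =
     (THE B. trunc l B = B \<and> block_mult (trunc l A) B = trunc l block_id
                           \<and> block_mult B (trunc l A) = trunc l block_id)"

text \<open>\<open>row_mat_col l u A v\<close> is the product of the block row \<open>(u\<^sub>0, ..., u\<^bsub>l-1\<^esub>)\<close>, the truncated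
  block matrix \<open>A\<close> and the block column with blocks \<open>v\<^sub>0, ..., v\<^bsub>l-1\<^esub>\<close>. The entries of
  \<open>u\<close> are the blocks of the row as they stand, already transposed if the row is the transpose of
  a block column.\<close>

definition row_mat_col ::
  "nat \<Rightarrow> 'N::finite block_vec \<Rightarrow> 'N block_mat \<Rightarrow> 'N block_vec \<Rightarrow> 'N blk" where
  "row_mat_col l u A v = (\<Sum>i<l. \<Sum>k<l. u i ** A i k ** v k)"

definition e_block :: "nat \<Rightarrow> 'N::finite block_vec" where
  "e_block i = (\<lambda>k. if k = i then mat 1 else 0)"


subsection \<open>Weights and moment matrix\<close>

definition chi1 :: "real \<Rightarrow> 'N::finite block_vec" where
  "chi1 x = (\<lambda>i. mat (of_real (x ^ i)))"

definition chi2 :: "(nat \<Rightarrow> real \<Rightarrow> 'N::finite blk) \<Rightarrow> real \<Rightarrow> 'N block_vec" where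
  "chi2 \<rho> x = (\<lambda>j. transpose (\<rho> j x))"

definition finite_moments :: "(nat \<Rightarrow> real \<Rightarrow> 'N::finite blk) \<Rightarrow> bool" where
  "finite_moments \<rho> \<longleftrightarrow> (\<forall>i j. integrable lebesgue (\<lambda>x. (x ^ i) *\<^sub>R \<rho> j x))"

definition periodic_weights ::
  "('N::finite \<Rightarrow> nat) \<Rightarrow> ('N \<Rightarrow> nat) \<Rightarrow> (nat \<Rightarrow> real \<Rightarrow> 'N blk) \<Rightarrow> bool" where
  "periodic_weights n m \<rho> \<longleftrightarrow>
     (\<forall>j a b x. \<rho> (j + m b) x $ a $ b = of_real (x ^ n a) * \<rho> j x $ a $ b)"

definition moment_matrix :: "(nat \<Rightarrow> real \<Rightarrow> 'N::finite blk) \<Rightarrow> 'N block_mat" where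
  "moment_matrix \<rho> = (\<lambda>i j. \<integral>x. (x ^ i) *\<^sub>R \<rho> j x \<partial>lebesgue)"

definition block_LU_factorization ::
  "'N::finite block_mat \<Rightarrow> 'N block_mat \<Rightarrow> 'N block_mat \<Rightarrow> bool" where
  "block_LU_factorization g S St \<longleftrightarrow>
     block_lower S \<and> (\<forall>i. S i i = mat 1) \<and>
     block_upper St \<and> (\<forall>i. invertible (St i i)) \<and>
     g = block_mult (lower_inv S) St"


subsection \<open>Polynomials, kernel and associated polynomials\<close>

definition p_poly :: "'N::finite block_mat \<Rightarrow> nat \<Rightarrow> real \<Rightarrow> 'N blk" where
  "p_poly S k x = block_mult_vec S (chi1 x) k"

definition p_tilde :: "(nat \<Rightarrow> real \<Rightarrow> 'N::finite blk) \<Rightarrow> 'N block_mat \<Rightarrow> nat \<Rightarrow> real \<Rightarrow> 'N blk" where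
  "p_tilde \<rho> St k x = block_mult_vec (block_transpose (upper_inv St)) (chi2 \<rho> x) k"

definition CD_kernel ::
  "(nat \<Rightarrow> real \<Rightarrow> 'N::finite blk) \<Rightarrow> 'N block_mat \<Rightarrow> 'N block_mat \<Rightarrow> nat
     \<Rightarrow> real \<Rightarrow> real \<Rightarrow> 'N blk" where
  "CD_kernel \<rho> S St l x y = (\<Sum>k<l. transpose (p_tilde \<rho> St k x) ** p_poly S k y)"

definition p_plus ::
  "(nat \<Rightarrow> real \<Rightarrow> 'N::finite blk) \<Rightarrow> nat \<Rightarrow> nat \<Rightarrow> real \<Rightarrow> 'N blk" where
  "p_plus \<rho> l j x = (let g = moment_matrix \<rho> in
     chi1 x (l + j) - row_mat_col l (\<lambda>i. g (l + j) i) (trunc_inv l g) (chi1 x))"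

definition p_tilde_plus ::
  "(nat \<Rightarrow> real \<Rightarrow> 'N::finite blk) \<Rightarrow> nat \<Rightarrow> nat \<Rightarrow> real \<Rightarrow> 'N blk" where
  "p_tilde_plus \<rho> l j x = (let g = moment_matrix \<rho> in transpose
     (transpose (chi2 \<rho> x (l + j)) -
      row_mat_col l (\<lambda>i. transpose (chi2 \<rho> x i)) (trunc_inv l g) (\<lambda>i. g i (l + j))))"

text \<open>The following two are meant for \<open>j \<le> l\<close> only.\<close>

definition p_minus ::
  "(nat \<Rightarrow> real \<Rightarrow> 'N::finite blk) \<Rightarrow> nat \<Rightarrow> nat \<Rightarrow> real \<Rightarrow> 'N blk" where
  "p_minus \<rho> l j x = (let g = moment_matrix \<rho> in
     row_mat_col (l + 1) (\<lambda>i. transpose (e_block (l - j) i)) (trunc_inv (l + 1) g) (chi1 x))"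

definition p_tilde_minus ::
  "(nat \<Rightarrow> real \<Rightarrow> 'N::finite blk) \<Rightarrow> nat \<Rightarrow> nat \<Rightarrow> real \<Rightarrow> 'N blk" where
  "p_tilde_minus \<rho> l j x = (let g = moment_matrix \<rho> in transpose
     (row_mat_col (l + 1) (\<lambda>i. transpose (chi2 \<rho> x i)) (trunc_inv (l + 1) g) (e_block (l - j))))"

end

theory Submission
  imports Defs
begin

text \<open>With \<open>R\<close> the inverse of the truncated moment matrix, \<open>K(x,y) = \<Sum> u\<^sub>i R\<^sub>i\<^sub>k v\<^sub>k\<close> where
  \<open>u\<^sub>i = \<rho>\<^sub>i(x)\<close> and \<open>v\<^sub>k = y\<^sup>k\<close>. Multiplication by \<open>x\<^sup>n\<close> shifts the indices of \<open>u\<close> and multiplication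
  by \<open>y\<^sup>n\<close> those of \<open>v\<close>. Subtract from each shifted \<open>u\<^sub>t\<close> its projection
  \<open>\<Sum> u\<^sub>i R\<^sub>i\<^sub>k g\<^sub>k\<^sub>t\<close>, and similarly for \<open>v\<close>: by the symmetry of \<open>g\<close> the projections contribute the same
  to both terms and cancel, and the remainders vanish for \<open>t < l\<close>, so only the associated polynomials
  survive.\<close>

subsection \<open>Semi-infinite block matrices\<close>

lemma matrix_add_rdistrib:
  fixes A :: "'a::semiring_1^'n::finite^'m"
  shows "(A + B) ** C = A ** C + B ** C"
  by (simp add: matrix_matrix_mult_def vec_eq_iff distrib_right sum.distrib)

lemma sum_matrix_mult_right:
  fixes A :: "'i \<Rightarrow> 'a::semiring_1^'n::finite^'m"
  shows "(\<Sum>k\<in>F. A k) ** B = (\<Sum>k\<in>F. A k ** B)"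
  by (induction F rule: infinite_finite_induct) (simp_all add: matrix_add_rdistrib)

lemma sum_matrix_mult_left:
  fixes A :: "'a::semiring_1^'n::finite^'m"
  shows "A ** (\<Sum>k\<in>F. B k) = (\<Sum>k\<in>F. A ** B k)"
  by (induction F rule: infinite_finite_induct) (simp_all add: matrix_add_ldistrib)

lemma transpose_sum: "transpose (\<Sum>k\<in>F. A k) = (\<Sum>k\<in>F. transpose (A k))"
  by (simp add: transpose_def vec_eq_iff)

lemma transpose_zero [simp]: "transpose 0 = 0"
  by (simp add: transpose_def vec_eq_iff)

lemma Sum_any_eq_sum_lessThan:
  fixes f :: "nat \<Rightarrow> 'a::comm_monoid_add"
  assumes "\<And>k. k \<ge> l \<Longrightarrow> f k = 0"
  shows "Sum_any f = (\<Sum>k<l. f k)"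
  using assms by (intro Sum_any.expand_superset) (auto simp: not_less[symmetric])

text \<open>\<open>Sum_any\<close> returns 0 on an infinite support, so a product is meaningful only
  once its support is bounded. The disjunction lets either factor supply the bound.\<close>

lemma block_mult_eq_sum:
  assumes "\<And>k. k \<ge> l \<Longrightarrow> A i k = 0 \<or> B k j = 0"
  shows "block_mult A B i j = (\<Sum>k<l. A i k ** B k j)"
  unfolding block_mult_def by (rule Sum_any_eq_sum_lessThan) (use assms in force)

text \<open>A finiteness condition shared by block lower triangular matrices and truncations: as a
  left factor, such a matrix makes every entry of a product a finite sum.\<close>

definition row_finite :: "'N::finite block_mat \<Rightarrow> bool" where
  "row_finite A \<longleftrightarrow> (\<forall>i. \<exists>l. \<forall>k\<ge>l. A i k = 0)"

lemma row_finite_lower: "block_lower A \<Longrightarrow> row_finite A"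
  unfolding row_finite_def block_lower_def by (meson Suc_le_lessD)

lemma row_finite_trunc: "row_finite (trunc l A)"
  unfolding row_finite_def trunc_def by (meson not_le)

text \<open>Row finiteness of \<open>A\<close> and \<open>B\<close> makes each entry a finite double
  sum, whose order of summation can be exchanged.\<close>

lemma block_mult_assoc:
  assumes "row_finite A" "row_finite B"
  shows "block_mult (block_mult A B) C = block_mult A (block_mult B C)"
proof (intro ext)
  fix i j
  obtain l where l: "\<And>k. k \<ge> l \<Longrightarrow> A i k = 0"
    using assms(1) unfolding row_finite_def by metis
  obtain h where h: "\<And>p k. k \<ge> h p \<Longrightarrow> B p k = 0"
    using assms(2) unfolding row_finite_def by metis
  \<comment> \<open>Only the rows p < l of \<open>B\<close> matter. The sum of their bounds
    dominates each of them, so \<open>q\<close> bounds all these rows at once.\<close>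
  define q where "q = (\<Sum>p<l. h p)"
  have B0: "B p k = 0" if "p < l" "k \<ge> q" for p k
    using that member_le_sum[of p "{..<l}" h] by (intro h) (auto simp: q_def)
  have AB: "block_mult A B i k = (\<Sum>p<l. A i p ** B p k)" for k
    by (rule block_mult_eq_sum) (simp add: l)
  have "block_mult (block_mult A B) C i j = (\<Sum>k<q. block_mult A B i k ** C k j)"
    by (rule block_mult_eq_sum) (simp add: AB B0)
  also have "\<dots> = (\<Sum>k<q. \<Sum>p<l. A i p ** (B p k ** C k j))"
    by (simp add: AB sum_matrix_mult_right matrix_mul_assoc)
  also have "\<dots> = (\<Sum>p<l. A i p ** (\<Sum>k<q. B p k ** C k j))"
    by (subst sum.swap) (simp add: sum_matrix_mult_left)
  also have "\<dots> = (\<Sum>p<l. A i p ** block_mult B C p j)"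
    by (intro sum.cong refl arg_cong2[where f = "(**)"] block_mult_eq_sum[symmetric])
       (simp add: B0)
  also have "\<dots> = block_mult A (block_mult B C) i j"
    by (rule block_mult_eq_sum[symmetric]) (simp add: l)
  finally show "block_mult (block_mult A B) C i j = block_mult A (block_mult B C) i j" .
qed

lemma block_mult_id_left: "block_mult block_id A = A"
proof (intro ext)
  fix i j
  have "block_mult block_id A i j = (\<Sum>k<Suc i. block_id i k ** A k j)"
    by (rule block_mult_eq_sum) (simp add: block_id_def)
  also have "\<dots> = (\<Sum>k<Suc i. if k = i then A k j else 0)"
    by (rule sum.cong) (auto simp: block_id_def)
  finally show "block_mult block_id A i j = A i j" by simp
qed

lemma block_mult_id_right: "block_mult A block_id = A"
proof (intro ext)
  fix i j
  have "block_mult A block_id i j = (\<Sum>k<Suc j. A i k ** block_id k j)"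
    by (rule block_mult_eq_sum) (simp add: block_id_def)
  also have "\<dots> = (\<Sum>k<Suc j. if k = j then A i k else 0)"
    by (rule sum.cong) (auto simp: block_id_def)
  finally show "block_mult A block_id i j = A i j" by simp
qed

lemma block_transpose_transpose [simp]: "block_transpose (block_transpose A) = A"
  by (simp add: block_transpose_def)

lemma block_transpose_id [simp]: "block_transpose block_id = block_id"
  by (simp add: block_transpose_def block_id_def fun_eq_iff)

lemma block_transpose_mult:
  assumes "row_finite A"
  shows "block_transpose (block_mult A B) = block_mult (block_transpose B) (block_transpose A)"
proof (intro ext)
  fix i j
  obtain l where l: "\<And>k. k \<ge> l \<Longrightarrow> A j k = 0"
    using assms unfolding row_finite_def by metis
  have "block_transpose (block_mult A B) i j = transpose (\<Sum>k<l. A j k ** B k i)"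
    unfolding block_transpose_def by (subst block_mult_eq_sum[of l]) (simp_all add: l)
  also have "\<dots> = (\<Sum>k<l. block_transpose B i k ** block_transpose A k j)"
    by (simp add: transpose_sum matrix_transpose_mul block_transpose_def)
  also have "\<dots> = block_mult (block_transpose B) (block_transpose A) i j"
    by (rule block_mult_eq_sum[symmetric]) (simp add: l block_transpose_def)
  finally show "block_transpose (block_mult A B) i j
      = block_mult (block_transpose B) (block_transpose A) i j" .
qed

lemma block_lower_transpose: "block_lower (block_transpose A) \<longleftrightarrow> block_upper A"
  unfolding block_lower_def block_upper_def block_transpose_def
  by (metis transpose_transpose transpose_zero)

lemma block_upper_transpose: "block_upper (block_transpose A) \<longleftrightarrow> block_lower A"
  by (metis block_lower_transpose block_transpose_transpose)

subsection \<open>Inverses of triangular and truncated matrices\<close>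

text \<open>Forward substitution.\<close>

function lower_right_inv :: "'N::finite block_mat \<Rightarrow> 'N block_mat" where
  "lower_right_inv A i j =
     matrix_inv (A i i) ** (block_id i j - (\<Sum>k<i. A i k ** lower_right_inv A k j))"
  by auto
termination by (relation "Wellfounded.measure (\<lambda>(A, i, j). i)") auto

declare lower_right_inv.simps [simp del]

lemma lower_right_inv_lower: "i < j \<Longrightarrow> lower_right_inv A i j = 0"
proof (induction i rule: less_induct)
  case (less i)
  then show ?case
    by (subst lower_right_inv.simps) (auto simp: block_id_def)
qed

lemma matrix_inv_mult:
  fixes A :: "'a::semiring_1^'n^'m::finite"
  assumes "invertible A"
  shows "A ** matrix_inv A = mat 1" "matrix_inv A ** A = mat 1"
proof -
  have "A ** matrix_inv A = mat 1 \<and> matrix_inv A ** A = mat 1"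
    using assms unfolding invertible_def matrix_inv_def by (rule someI_ex)
  then show "A ** matrix_inv A = mat 1" "matrix_inv A ** A = mat 1"
    by auto
qed

lemma lower_right_inv:
  assumes "block_lower A" "\<And>i. invertible (A i i)"
  shows "block_mult A (lower_right_inv A) = block_id"
proof (intro ext)
  fix i j
  have "block_mult A (lower_right_inv A) i j = (\<Sum>k<Suc i. A i k ** lower_right_inv A k j)"
    by (rule block_mult_eq_sum) (use assms(1) in \<open>auto simp: block_lower_def\<close>)
  \<comment> \<open>The summand k = i is split off: the diagonal block cancels its inverse, and the
    subtracted sum restores the summands k < i.\<close>
  also have "A i i ** lower_right_inv A i j
      = block_id i j - (\<Sum>k<i. A i k ** lower_right_inv A k j)"
    by (subst lower_right_inv.simps) (simp add: matrix_mul_assoc matrix_inv_mult assms(2))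
  then have "(\<Sum>k<Suc i. A i k ** lower_right_inv A k j) = block_id i j"
    by simp
  finally show "block_mult A (lower_right_inv A) i j = block_id i j" .
qed

text \<open>B = B(AC) = (BA)C = C; the finiteness conditions are those that associativity
  requires.\<close>

lemma block_inverse_unique:
  assumes "row_finite B" "row_finite A" "block_mult B A = block_id" "block_mult A C = block_id"
  shows "B = C"
  by (metis assms block_mult_assoc block_mult_id_left block_mult_id_right)

text \<open>Forward substitution gives only a right inverse \<open>B\<close>. It is again lower
  triangular with invertible diagonal blocks, so it has a right inverse itself, which must be
  \<open>A\<close>; hence \<open>B\<close> is two-sided.\<close>

lemma lower_inverse_exists:
  assumes "block_lower A" "\<And>i. invertible (A i i)"
  shows "\<exists>B. block_lower B \<and> block_mult A B = block_id \<and> block_mult B A = block_id"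
proof -
  define B where "B = lower_right_inv A"
  have B: "block_lower B" "block_mult A B = block_id"
    using lower_right_inv[OF assms] by (auto simp: B_def block_lower_def lower_right_inv_lower)
  \<comment> \<open>On the diagonal the correction sum vanishes, since \<open>B k i\<close> is 0 for
    k < i.\<close>
  have "B i i = matrix_inv (A i i)" for i
    unfolding B_def by (subst lower_right_inv.simps) (simp add: block_id_def lower_right_inv_lower)
  then have "invertible (B i i)" for i
    using matrix_inv_mult[OF assms(2)[of i]] by (auto simp: invertible_def)
  from lower_right_inv[OF B(1) this]
  have "block_mult B (lower_right_inv B) = block_id" .
  moreover from this have "A = lower_right_inv B"
    using block_inverse_unique B assms(1) row_finite_lower by blast
  ultimately show ?thesis
    using B by auto
qed

lemma lower_inv:
  assumes "block_lower A" "\<And>i. invertible (A i i)"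
  shows "block_lower (lower_inv A)" "block_mult A (lower_inv A) = block_id"
    "block_mult (lower_inv A) A = block_id"
proof -
  have "\<exists>!B. block_lower B \<and> block_mult A B = block_id \<and> block_mult B A = block_id"
    using lower_inverse_exists[OF assms] block_inverse_unique row_finite_lower assms(1) by metis
  from theI'[OF this]
  show "block_lower (lower_inv A)" "block_mult A (lower_inv A) = block_id"
    "block_mult (lower_inv A) A = block_id"
    by (auto simp: lower_inv_def)
qed

text \<open>Upper triangular matrices may have infinitely many nonzero blocks in a row, so
  associativity does not apply to them directly. Existence and uniqueness are both transported from
  the lower triangular case by transposition.\<close>

lemma upper_inv:
  assumes "block_upper A" "\<And>i. invertible (A i i)"
  shows "block_upper (upper_inv A)" "block_mult A (upper_inv A) = block_id"
    "block_mult (upper_inv A) A = block_id"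
proof -
  let ?T = block_transpose
  have lowT: "block_lower (?T A)"
    using assms(1) by (simp add: block_lower_transpose)
  have "invertible (?T A i i)" for i
    using assms(2)[of i] unfolding block_transpose_def invertible_def
    by (metis matrix_transpose_mul transpose_mat)
  then obtain B where B: "block_lower B" "block_mult (?T A) B = block_id"
      "block_mult B (?T A) = block_id"
    using lower_inverse_exists[OF lowT] by blast
  have TB: "block_upper (?T B)" "block_mult A (?T B) = block_id" "block_mult (?T B) A = block_id"
    using B lowT block_transpose_mult[of B "?T A"] block_transpose_mult[of "?T A" B]
    by (auto simp: block_upper_transpose row_finite_lower)
  have "C = ?T B"
    if C: "block_upper C" "block_mult A C = block_id" "block_mult C A = block_id" for C
  proof -
    have "block_mult (?T A) (?T C) = ?T (block_mult C A)"
      using C(1) lowT block_transpose_mult[of "?T A" "?T C"]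
      by (metis block_transpose_transpose row_finite_lower)
    then have "B = ?T C"
      using B lowT C by (intro block_inverse_unique[of B "?T A"]) (auto simp: row_finite_lower)
    then show ?thesis by simp
  qed
  then have "\<exists>!B. block_upper B \<and> block_mult A B = block_id \<and> block_mult B A = block_id"
    using TB by blast
  from theI'[OF this]
  show "block_upper (upper_inv A)" "block_mult A (upper_inv A) = block_id"
    "block_mult (upper_inv A) A = block_id"
    by (auto simp: upper_inv_def)
qed

section \<open>Truncations and the inverse of the truncated moment matrix\<close>

lemma trunc_trunc [simp]: "trunc l (trunc l A) = trunc l A"
  by (simp add: trunc_def fun_eq_iff)

lemma block_mult_trunc:
  "block_mult (trunc l A) (trunc l B) i j
     = (if i < l \<and> j < l then \<Sum>k<l. A i k ** B k j else 0)"
proof -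
  have "block_mult (trunc l A) (trunc l B) i j = (\<Sum>k<l. trunc l A i k ** trunc l B k j)"
    by (rule block_mult_eq_sum) (simp add: trunc_def)
  also have "\<dots> = (if i < l \<and> j < l then \<Sum>k<l. A i k ** B k j else 0)"
    by (auto simp: trunc_def)
  finally show ?thesis .
qed

lemma trunc_block_mult_trunc [simp]:
  "trunc l (block_mult (trunc l A) (trunc l B)) = block_mult (trunc l A) (trunc l B)"
  by (auto simp: trunc_def block_mult_trunc[unfolded trunc_def] fun_eq_iff)

text \<open>Truncation is not multiplicative in general. Here it is, because a row i < l of a lower
  factor, or a column j < l of an upper one, has no nonzero block at or beyond position l.\<close>

lemma trunc_mult:
  assumes "block_lower A \<or> block_upper B"
  shows "block_mult (trunc l A) (trunc l B) = trunc l (block_mult A B)"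
proof (intro ext)
  fix i j
  have "block_mult A B i j = (\<Sum>k<l. A i k ** B k j)" if "i < l" "j < l"
    by (rule block_mult_eq_sum) (use that assms in \<open>auto simp: block_lower_def block_upper_def\<close>)
  then show "block_mult (trunc l A) (trunc l B) i j = trunc l (block_mult A B) i j"
    unfolding block_mult_trunc by (simp add: trunc_def)
qed

lemma block_lower_id: "block_lower block_id" and block_upper_id: "block_upper block_id"
  by (auto simp: block_lower_def block_upper_def block_id_def)

lemma trunc_id_mult: "block_mult (trunc l block_id) (trunc l A) = trunc l A"
  by (simp add: trunc_mult block_lower_id block_mult_id_left)

lemma mult_trunc_id: "block_mult (trunc l A) (trunc l block_id) = trunc l A"
  by (simp add: trunc_mult block_upper_id block_mult_id_right)

lemma trunc_inv_eqI:
  assumes "trunc l R = R" "block_mult (trunc l A) R = trunc l block_id"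
    "block_mult R (trunc l A) = trunc l block_id"
  shows "trunc_inv l A = R"
  unfolding trunc_inv_def
proof (rule the_equality)
  fix B
  assume B: "trunc l B = B \<and> block_mult (trunc l A) B = trunc l block_id
    \<and> block_mult B (trunc l A) = trunc l block_id"
  have "B = block_mult B (block_mult (trunc l A) R)"
    using B assms by (metis mult_trunc_id)
  also have "\<dots> = block_mult (block_mult B (trunc l A)) R"
    using B by (metis block_mult_assoc row_finite_trunc)
  also have "\<dots> = R"
    using B assms by (metis trunc_id_mult)
  finally show "B = R" .
qed (use assms in auto)

text \<open>As \<open>g\<close> is lower times upper, truncation passes to its factors, and each
  truncated factor is inverted by the truncation of its inverse. The product \<open>R\<close> is
  upper times lower, so it has to be formed from truncated factors.\<close>

lemma block_LU_trunc_inv: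
  fixes l :: nat
  assumes "block_LU_factorization g S St"
  defines "R \<equiv> block_mult (trunc l (upper_inv St)) (trunc l S)"
  shows "trunc_inv l g = R" "block_mult (trunc l g) R = trunc l block_id"
    "block_mult R (trunc l g) = trunc l block_id" "trunc l R = R"
proof -
  have S: "block_lower S" "\<And>i. invertible (S i i)"
    and St: "block_upper St" "\<And>i. invertible (St i i)"
    and g: "g = block_mult (lower_inv S) St"
    using assms by (auto simp: block_LU_factorization_def invertible_def)
  note L = lower_inv[OF S] and U = upper_inv[OF St]
  have Tg: "trunc l g = block_mult (trunc l (lower_inv S)) (trunc l St)"
    unfolding g by (simp add: trunc_mult L(1))
  note assoc = block_mult_assoc[OF row_finite_trunc row_finite_trunc]
  have StU: "block_mult (trunc l St) (trunc l (upper_inv St)) = trunc l block_id"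
    and USt: "block_mult (trunc l (upper_inv St)) (trunc l St) = trunc l block_id"
    and SL: "block_mult (trunc l S) (trunc l (lower_inv S)) = trunc l block_id"
    and LS: "block_mult (trunc l (lower_inv S)) (trunc l S) = trunc l block_id"
    using S St L U by (simp_all add: trunc_mult)
  show T: "trunc l R = R"
    by (simp add: R_def)
  have "block_mult (trunc l g) R = block_mult (trunc l (lower_inv S))
      (block_mult (block_mult (trunc l St) (trunc l (upper_inv St))) (trunc l S))"
    unfolding Tg R_def by (simp add: assoc)
  then show gR: "block_mult (trunc l g) R = trunc l block_id"
    by (simp add: StU trunc_id_mult LS)
  have "block_mult R (trunc l g) = block_mult (trunc l (upper_inv St))
      (block_mult (block_mult (trunc l S) (trunc l (lower_inv S))) (trunc l St))"
    unfolding Tg R_def by (simp add: assoc)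
  then show Rg: "block_mult R (trunc l g) = trunc l block_id"
    by (simp add: SL trunc_id_mult USt)
  show "trunc_inv l g = R"
    using T gR Rg by (rule trunc_inv_eqI)
qed

lemma block_LU_trunc_inv_sums:
  assumes "block_LU_factorization g S St" and "i < l" "j < l"
  shows "(\<Sum>k<l. g i k ** trunc_inv l g k j) = (if i = j then mat 1 else 0)"
    and "(\<Sum>k<l. trunc_inv l g i k ** g k j) = (if i = j then mat 1 else 0)"
proof -
  let ?R = "trunc_inv l g"
  \<comment> \<open>Folding replaces the explicit product by \<open>trunc_inv l g\<close> in all the
    facts.\<close>
  note R = block_LU_trunc_inv[OF assms(1), of l, folded block_LU_trunc_inv(1)[OF assms(1), of l]]
  have "block_mult (trunc l g) (trunc l ?R) i j = trunc l block_id i j"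
    and "block_mult (trunc l ?R) (trunc l g) i j = trunc l block_id i j"
    using R by simp_all
  then show "(\<Sum>k<l. g i k ** ?R k j) = (if i = j then mat 1 else 0)"
    and "(\<Sum>k<l. ?R i k ** g k j) = (if i = j then mat 1 else 0)"
    using assms(2,3) unfolding block_mult_trunc by (simp_all add: trunc_def block_id_def)
qed

subsection \<open>The kernel and the symmetry of the moment matrix\<close>

text \<open>For q < l triangularity confines \<open>p_poly S q\<close> and
  \<open>p_tilde \<rho> St q\<close> to the first l blocks of \<open>chi1\<close> and
  \<open>chi2\<close>. Summing over q then joins the two triangular factors to the truncated
  inverse.\<close>

lemma CD_kernel_eq:
  assumes "block_LU_factorization (moment_matrix \<rho>) S St"
  shows "CD_kernel \<rho> S St l x y
    = row_mat_col l (\<lambda>i. \<rho> i x) (trunc_inv l (moment_matrix \<rho>)) (chi1 y)"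
proof -
  let ?U = "upper_inv St" and ?R = "trunc_inv l (moment_matrix \<rho>)"
  have S: "block_lower S" and U: "block_upper ?U"
    using assms upper_inv(1)[of St] by (auto simp: block_LU_factorization_def)
  have R: "?R i k = (\<Sum>q<l. ?U i q ** S q k)" if "i < l" "k < l" for i k
    using that block_LU_trunc_inv(1)[OF assms, of l] by (simp add: block_mult_trunc)
  have p: "p_poly S q y = (\<Sum>k<l. S q k ** chi1 y k)" if "q < l" for q
    unfolding p_poly_def block_mult_vec_def
    by (rule Sum_any_eq_sum_lessThan) (use S that in \<open>auto simp: block_lower_def\<close>)
  have pt: "transpose (p_tilde \<rho> St q x) = (\<Sum>i<l. \<rho> i x ** ?U i q)" if "q < l" for q
  proof -
    have "p_tilde \<rho> St q x = (\<Sum>i<l. block_transpose ?U q i ** chi2 \<rho> x i)"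
      unfolding p_tilde_def block_mult_vec_def
      by (rule Sum_any_eq_sum_lessThan)
         (use U that in \<open>auto simp: block_upper_def block_transpose_def\<close>)
    then show ?thesis
      by (simp add: transpose_sum matrix_transpose_mul block_transpose_def chi2_def)
  qed
  have "CD_kernel \<rho> S St l x y
      = (\<Sum>q<l. \<Sum>i<l. \<Sum>k<l. \<rho> i x ** (?U i q ** S q k) ** chi1 y k)"
    by (simp add: CD_kernel_def p pt sum_matrix_mult_right sum_matrix_mult_left matrix_mul_assoc)
       (rule sum.cong[OF refl], rule sum.swap)
  also have "\<dots> = (\<Sum>i<l. \<Sum>k<l. \<Sum>q<l. \<rho> i x ** (?U i q ** S q k) ** chi1 y k)"
    by (subst sum.swap) (intro sum.cong refl sum.swap)
  also have "\<dots> = row_mat_col l (\<lambda>i. \<rho> i x) ?R (chi1 y)"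
    by (simp add: row_mat_col_def R sum_matrix_mult_right sum_matrix_mult_left)
  finally show ?thesis .
qed

section \<open>Diagonal matrix units and the shifts caused by the periodicity of the weights\<close>

lemma E_nth: "E a $ i $ j = (if i = a \<and> j = a then 1 else 0)"
  by (simp add: E_def axis_def)

lemma E_mult_nth: "(E a ** A) $ i $ j = (if i = a then A $ i $ j else 0)"
  by (simp add: matrix_matrix_mult_def E_nth mult_delta_left)

lemma mult_E_nth: "(A ** E a) $ i $ j = (if j = a then A $ i $ j else 0)"
  by (simp add: matrix_matrix_mult_def E_nth mult_delta_right)

lemma mat_mult_nth: "(mat c ** A) $ i $ j = c * A $ i $ j"
  by (simp add: matrix_matrix_mult_def mat_def mult_delta_left)

lemma scaleR_matrix_mult_left: "(c *\<^sub>R A) ** B = c *\<^sub>R (A ** (B :: complex^'n::finite^'m::finite))"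
  by (simp add: matrix_matrix_mult_def vec_eq_iff scaleR_sum_right)

lemma multi_pow_mult_nth: "(multi_pow x n ** A) $ i $ j = (x ^ n i) *\<^sub>R A $ i $ j"
  by (simp add: multi_pow_def sum_matrix_mult_right scaleR_matrix_mult_left E_mult_nth
      if_distrib[of "(*\<^sub>R) _"] cong: if_cong)

text \<open>The left factor scales row a by x^{n_a}, which periodicity turns into a shift by m_b in
  column b; \<open>E b\<close> on the right selects that column.\<close>

lemma multi_pow_mult_weight:
  assumes "periodic_weights n m \<rho>"
  shows "multi_pow x n ** \<rho> j x = (\<Sum>b\<in>UNIV. \<rho> (j + m b) x ** E b)"
  using assms
  by (simp add: vec_eq_iff multi_pow_mult_nth mult_E_nth periodic_weights_def scaleR_conv_of_real)

text \<open>The blocks of \<open>chi1\<close> are scalar matrices and commute with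
  \<open>E a\<close>, so each power of y is absorbed into a shift of the index.\<close>

lemma chi1_mult_multi_pow: "chi1 y k ** multi_pow y n = (\<Sum>a\<in>UNIV. E a ** chi1 y (k + n a))"
proof -
  have *: "mat c ** (t *\<^sub>R E a) = E a ** (mat (of_real t * c) :: complex^'a^'a)"
    for c t and a :: 'a
    by (simp add: vec_eq_iff E_mult_nth mat_mult_nth E_nth scaleR_conv_of_real[where 'a = complex])
       (simp add: mat_def)
  show ?thesis
    by (simp add: multi_pow_def chi1_def sum_matrix_mult_left * power_add mult.commute)
qed

text \<open>Taking an entry is bounded linear, so it commutes with the integral of an integrable
  function; this is where finiteness of the moments enters.\<close>

lemma moment_matrix_nth:
  assumes "finite_moments \<rho>"
  shows "moment_matrix \<rho> i j $ a $ b = (\<integral>x. (x ^ i) *\<^sub>R \<rho> j x $ a $ b \<partial>lebesgue)"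
proof -
  have int: "integrable lebesgue (\<lambda>x. (x ^ i) *\<^sub>R \<rho> j x)"
    using assms by (simp add: finite_moments_def)
  have "bounded_linear (\<lambda>A :: complex^'a^'a. A $ a $ b)"
    by (rule bounded_linear_compose[OF bounded_linear_vec_nth bounded_linear_vec_nth])
  from integral_bounded_linear[OF this int] show ?thesis
    by (simp add: moment_matrix_def)
qed

text \<open>The block form of the multigraded Hankel symmetry: in both sums the entry (a, b) is the
  integral of x^{i + n_a} times the (a, b) entry of \<open>\<rho> j x\<close>.\<close>

lemma moment_matrix_symmetry:
  assumes "finite_moments \<rho>" "periodic_weights n m \<rho>"
  shows "(\<Sum>a\<in>UNIV. E a ** moment_matrix \<rho> (i + n a) j)
    = (\<Sum>b\<in>UNIV. moment_matrix \<rho> i (j + m b) ** E b)"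
  using assms(2)
  by (simp add: vec_eq_iff E_mult_nth mult_E_nth moment_matrix_nth[OF assms(1)]
      periodic_weights_def scaleR_conv_of_real power_add mult.assoc)

subsection \<open>The Christoffel-Darboux formula\<close>

text \<open>Meant for summands containing a remainder at the shifted index i + m, which vanishes
  below l: only the last m terms survive.\<close>

lemma sum_lessThan_tail:
  fixes f :: "nat \<Rightarrow> 'a::comm_monoid_add"
  assumes "m \<le> l" "\<And>i. i + m < l \<Longrightarrow> f i = 0"
  shows "(\<Sum>i<l. f i) = (\<Sum>j<m. f (l - m + j))"
proof -
  have "(\<Sum>i<l. f i) = (\<Sum>i\<in>{l-m..<l}. f i)"
    using assms by (intro sum.mono_neutral_right) auto
  also have "\<dots> = (\<Sum>j<m. f (l - m + j))"
    by (rule sum.reindex_bij_witness[of _ "\<lambda>j. l - m + j" "\<lambda>i. i - (l - m)"])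
       (use assms(1) in auto)
  finally show ?thesis .
qed

text \<open>The formula freed from integrals and polynomials: \<open>X\<close> and \<open>Y\<close>
  are known only through the shifts they induce. In the application the blocks of \<open>uR\<close>
  and \<open>Rv\<close> become the associated polynomials with index l - 1.\<close>

lemma christoffel_darboux_algebraic:
  fixes u v :: "'N::finite block_vec" and g R :: "'N block_mat"
  assumes gR: "\<And>i j. i < l \<Longrightarrow> j < l \<Longrightarrow> (\<Sum>k<l. g i k ** R k j) = (if i = j then mat 1 else 0)"
    and Rg: "\<And>i j. i < l \<Longrightarrow> j < l \<Longrightarrow> (\<Sum>k<l. R i k ** g k j) = (if i = j then mat 1 else 0)"
    and sym: "\<And>i j. (\<Sum>a\<in>UNIV. E a ** g (i + n a) j) = (\<Sum>b\<in>UNIV. g i (j + m b) ** E b)"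
    and u: "\<And>i. X ** u i = (\<Sum>b\<in>UNIV. u (i + m b) ** E b)"
    and v: "\<And>k. v k ** Y = (\<Sum>a\<in>UNIV. E a ** v (k + n a))"
    and n: "\<And>a. n a \<le> l" and m: "\<And>a. m a \<le> l"
  defines "uR \<equiv> \<lambda>k. \<Sum>i<l. u i ** R i k" and "Rv \<equiv> \<lambda>i. \<Sum>k<l. R i k ** v k"
  shows "X ** row_mat_col l u R v - row_mat_col l u R v ** Y =
    (\<Sum>a\<in>UNIV.
      (\<Sum>j<m a. (u (l + j) - (\<Sum>k<l. uR k ** g k (l + j))) ** E a ** Rv (l - m a + j)) -
      (\<Sum>j<n a. uR (l - n a + j) ** E a ** (v (l + j) - (\<Sum>i<l. g (l + j) i ** Rv i))))"
proof -
  \<comment> \<open>The remainders after projection; at index l + j they become the associated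
    polynomials \<open>p_tilde_plus\<close> (transposed) and \<open>p_plus\<close>.\<close>
  define us where "us t = u t - (\<Sum>k<l. uR k ** g k t)" for t
  define vs where "vs t = v t - (\<Sum>i<l. g t i ** Rv i)" for t
  have us0: "us t = 0" if "t < l" for t
  proof -
    have "(\<Sum>k<l. uR k ** g k t) = (\<Sum>i<l. u i ** (\<Sum>k<l. R i k ** g k t))"
      unfolding uR_def sum_matrix_mult_left sum_matrix_mult_right
      by (subst sum.swap) (simp add: matrix_mul_assoc)
    also have "\<dots> = (\<Sum>i<l. if i = t then u i else 0)"
      by (rule sum.cong) (use that in \<open>auto simp: Rg\<close>)
    finally show ?thesis using that by (simp add: us_def)
  qed
  have vs0: "vs t = 0" if "t < l" for t
  proof -
    have "(\<Sum>i<l. g t i ** Rv i) = (\<Sum>k<l. (\<Sum>i<l. g t i ** R i k) ** v k)"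
      unfolding Rv_def sum_matrix_mult_left sum_matrix_mult_right
      by (subst sum.swap) (simp add: matrix_mul_assoc)
    also have "\<dots> = (\<Sum>k<l. if k = t then v k else 0)"
      by (rule sum.cong) (use that in \<open>auto simp: gR\<close>)
    finally show ?thesis using that by (simp add: vs_def)
  qed
  \<comment> \<open>Two bracketings of the kernel: u(Rv) exposes \<open>u\<close> to multiplication
    by \<open>X\<close>, and (uR)v exposes \<open>v\<close> to multiplication by
    \<open>Y\<close>.\<close>
  have Ku: "row_mat_col l u R v = (\<Sum>i<l. u i ** Rv i)"
    by (simp add: row_mat_col_def Rv_def sum_matrix_mult_left matrix_mul_assoc)
  have Kv: "row_mat_col l u R v = (\<Sum>k<l. uR k ** v k)"
    unfolding row_mat_col_def uR_def sum_matrix_mult_right by (rule sum.swap)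
  define Cu where "Cu = (\<Sum>b\<in>UNIV. \<Sum>i<l. \<Sum>k<l. uR k ** g k (i + m b) ** E b ** Rv i)"
  define Cv where "Cv = (\<Sum>a\<in>UNIV. \<Sum>k<l. \<Sum>i<l. uR k ** E a ** g (k + n a) i ** Rv i)"
  \<comment> \<open>Moving the sum over b innermost produces the right side of \<open>sym\<close>;
    its left side, a sum over a, then yields \<open>Cv\<close>.\<close>
  have "Cu = (\<Sum>i<l. \<Sum>k<l. \<Sum>b\<in>UNIV. uR k ** g k (i + m b) ** E b ** Rv i)"
    unfolding Cu_def by (subst sum.swap) (intro sum.cong refl sum.swap)
  also have "\<dots> = (\<Sum>i<l. \<Sum>k<l. uR k ** (\<Sum>b\<in>UNIV. g k (i + m b) ** E b) ** Rv i)"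
    by (simp add: sum_matrix_mult_left sum_matrix_mult_right matrix_mul_assoc)
  also have "\<dots> = (\<Sum>i<l. \<Sum>k<l. \<Sum>a\<in>UNIV. uR k ** E a ** g (k + n a) i ** Rv i)"
    by (simp add: sym[symmetric] sum_matrix_mult_left sum_matrix_mult_right matrix_mul_assoc)
  also have "\<dots> = (\<Sum>k<l. \<Sum>a\<in>UNIV. \<Sum>i<l. uR k ** E a ** g (k + n a) i ** Rv i)"
    by (subst sum.swap) (intro sum.cong refl sum.swap)
  also have "\<dots> = Cv"
    unfolding Cv_def by (rule sum.swap)
  finally have C: "Cu = Cv" .
  have "X ** row_mat_col l u R v = (\<Sum>i<l. (X ** u i) ** Rv i)"
    by (simp add: Ku sum_matrix_mult_left matrix_mul_assoc)
  also have "\<dots> = (\<Sum>b\<in>UNIV. \<Sum>i<l. u (i + m b) ** E b ** Rv i)"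
    unfolding u sum_matrix_mult_right by (rule sum.swap)
  also have "\<dots> = (\<Sum>b\<in>UNIV. \<Sum>i<l. us (i + m b) ** E b ** Rv i) + Cu"
  proof -
    have "u t = us t + (\<Sum>k<l. uR k ** g k t)" for t
      by (simp add: us_def)
    then show ?thesis
      unfolding Cu_def
      by (simp add: matrix_add_rdistrib sum.distrib sum_matrix_mult_right)
  qed
  finally have 1: "X ** row_mat_col l u R v
      = (\<Sum>b\<in>UNIV. \<Sum>i<l. us (i + m b) ** E b ** Rv i) + Cu" .
  have "row_mat_col l u R v ** Y = (\<Sum>k<l. uR k ** (v k ** Y))"
    by (simp add: Kv sum_matrix_mult_right matrix_mul_assoc)
  also have "\<dots> = (\<Sum>a\<in>UNIV. \<Sum>k<l. uR k ** E a ** v (k + n a))"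
    unfolding v sum_matrix_mult_left matrix_mul_assoc by (rule sum.swap)
  also have "\<dots> = (\<Sum>a\<in>UNIV. \<Sum>k<l. uR k ** E a ** vs (k + n a)) + Cv"
  proof -
    have "v t = vs t + (\<Sum>i<l. g t i ** Rv i)" for t
      by (simp add: vs_def)
    then show ?thesis
      unfolding Cv_def
      by (simp add: matrix_add_ldistrib sum.distrib sum_matrix_mult_left matrix_mul_assoc)
  qed
  finally have 2: "row_mat_col l u R v ** Y
      = (\<Sum>a\<in>UNIV. \<Sum>k<l. uR k ** E a ** vs (k + n a)) + Cv" .
  have t1: "(\<Sum>i<l. us (i + m b) ** E b ** Rv i)
      = (\<Sum>j<m b. us (l + j) ** E b ** Rv (l - m b + j))" for b
  proof -
    \<comment> \<open>Among the last m_b values of i, the j-th has shifted index exactly l + j; m_b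
      <= l keeps the subtraction of naturals exact.\<close>
    have "l - m b + j + m b = l + j" for j
      using m[of b] by simp
    then show ?thesis
      using m[of b] us0 by (subst sum_lessThan_tail[of "m b"]) auto
  qed
  have t2: "(\<Sum>k<l. uR k ** E a ** vs (k + n a))
      = (\<Sum>j<n a. uR (l - n a + j) ** E a ** vs (l + j))" for a
  proof -
    have "l - n a + j + n a = l + j" for j
      using n[of a] by simp
    then show ?thesis
      using n[of a] vs0 by (subst sum_lessThan_tail[of "n a"]) auto
  qed
  show ?thesis
    unfolding 1 2 C t1 t2 us_def[symmetric] vs_def[symmetric] by (simp add: sum_subtractf)
qed

section \<open>The associated polynomials in terms of the truncated inverse\<close>

lemma p_minus_eq:
  assumes "l \<ge> 1" "j < d" "d \<le> l"
  shows "p_minus \<rho> (l - 1) (d - j - 1) y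
    = (\<Sum>k<l. trunc_inv l (moment_matrix \<rho>) (l - d + j) k ** chi1 y k)"
proof -
  \<comment> \<open>With j < d <= l no subtraction is cut off at 0, so the unit block selects row l
    - d + j of the inverse of size (l - 1) + 1 = l.\<close>
  have idx: "l - 1 - (d - j - 1) = l - d + j" "l - 1 + 1 = l"
    using assms by auto
  show ?thesis
    unfolding p_minus_def Let_def idx row_mat_col_def
  proof (subst sum.swap, rule sum.cong[OF refl])
    fix k
    let ?R = "trunc_inv l (moment_matrix \<rho>)"
    have "(\<Sum>i<l. transpose (e_block (l - d + j) i) ** ?R i k ** chi1 y k)
        = (\<Sum>i<l. if i = l - d + j then ?R i k ** chi1 y k else 0)"
      by (rule sum.cong) (auto simp: e_block_def)
    then show "(\<Sum>i<l. transpose (e_block (l - d + j) i) ** ?R i k ** chi1 y k)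
        = ?R (l - d + j) k ** chi1 y k"
      using assms by simp
  qed
qed

lemma p_tilde_minus_eq:
  assumes "l \<ge> 1" "j < d" "d \<le> l"
  shows "transpose (p_tilde_minus \<rho> (l - 1) (d - j - 1) x)
    = (\<Sum>i<l. \<rho> i x ** trunc_inv l (moment_matrix \<rho>) i (l - d + j))"
proof -
  have idx: "l - 1 - (d - j - 1) = l - d + j" "l - 1 + 1 = l"
    using assms by auto
  show ?thesis
    unfolding p_tilde_minus_def Let_def idx row_mat_col_def transpose_transpose chi2_def
  proof (rule sum.cong[OF refl])
    fix i
    let ?R = "trunc_inv l (moment_matrix \<rho>)"
    have "(\<Sum>k<l. \<rho> i x ** ?R i k ** e_block (l - d + j) k)
        = (\<Sum>k<l. if k = l - d + j then \<rho> i x ** ?R i k else 0)"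
      by (rule sum.cong) (auto simp: e_block_def)
    then show "(\<Sum>k<l. \<rho> i x ** ?R i k ** e_block (l - d + j) k)
        = \<rho> i x ** ?R i (l - d + j)"
      using assms by simp
  qed
qed

lemma p_plus_eq:
  "p_plus \<rho> l j y = chi1 y (l + j) - (\<Sum>i<l. moment_matrix \<rho> (l + j) i **
     (\<Sum>k<l. trunc_inv l (moment_matrix \<rho>) i k ** chi1 y k))"
  by (simp add: p_plus_def Let_def row_mat_col_def sum_matrix_mult_left matrix_mul_assoc)

lemma p_tilde_plus_eq:
  "transpose (p_tilde_plus \<rho> l j x) = \<rho> (l + j) x - (\<Sum>k<l.
     (\<Sum>i<l. \<rho> i x ** trunc_inv l (moment_matrix \<rho>) i k) ** moment_matrix \<rho> k (l + j))"
  by (simp add: p_tilde_plus_def Let_def row_mat_col_def chi2_def sum_matrix_mult_right)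
     (rule sum.swap)

theorem theorem1:
  fixes n m :: "'N::finite \<Rightarrow> nat"
    and \<rho> :: "nat \<Rightarrow> real \<Rightarrow> complex^'N^'N"
    and S St :: "nat \<Rightarrow> nat \<Rightarrow> complex^'N^'N"
    and l :: nat and x y :: real
  assumes "finite_moments \<rho>"
    and "periodic_weights n m \<rho>"
    and "block_LU_factorization (moment_matrix \<rho>) S St"
    and "l \<ge> 1"
    and "l \<ge> max (\<Sum>a\<in>UNIV. n a) (\<Sum>a\<in>UNIV. m a)"
  shows "multi_pow x n ** CD_kernel \<rho> S St l x y - CD_kernel \<rho> S St l x y ** multi_pow y n =
    (\<Sum>a\<in>UNIV.
       (\<Sum>j<m a. transpose (p_tilde_plus \<rho> l j x) ** E a ** p_minus \<rho> (l - 1) (m a - j - 1) y) -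
       (\<Sum>j<n a. transpose (p_tilde_minus \<rho> (l - 1) (n a - j - 1) x) ** E a ** p_plus \<rho> l j y))"
proof -
  \<comment> \<open>The bound on the totals is used componentwise: each n_a and m_a is at most its
    total.\<close>
  have n: "n a \<le> l" and m: "m a \<le> l" for a
    using assms(5) member_le_sum[of a UNIV n] member_le_sum[of a UNIV m] by auto
  let ?g = "moment_matrix \<rho>"
  let ?R = "trunc_inv l ?g"
  show ?thesis
    unfolding CD_kernel_eq[OF assms(3)]
  proof (subst christoffel_darboux_algebraic[where u = "\<lambda>i. \<rho> i x" and v = "chi1 y" and g = ?g
      and R = ?R and X = "multi_pow x n" and Y = "multi_pow y n" and n = n and m = m])
    fix i j
    assume "i < l" "j < l"
    then show "(\<Sum>k<l. ?g i k ** ?R k j) = (if i = j then mat 1 else 0)"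
      and "(\<Sum>k<l. ?R i k ** ?g k j) = (if i = j then mat 1 else 0)"
      by (rule block_LU_trunc_inv_sums[OF assms(3)])+
  next
    \<comment> \<open>The abstract right side is matched summand by summand; the range j < m_a or j
      < n_a provides the index condition for the minus polynomials.\<close>
    show "(\<Sum>a\<in>UNIV.
        (\<Sum>j<m a. (\<rho> (l + j) x - (\<Sum>k<l. (\<Sum>i<l. \<rho> i x ** ?R i k) ** ?g k (l + j))) ** E a **
          (\<Sum>k<l. ?R (l - m a + j) k ** chi1 y k)) -
        (\<Sum>j<n a. (\<Sum>i<l. \<rho> i x ** ?R i (l - n a + j)) ** E a **
          (chi1 y (l + j) - (\<Sum>i<l. ?g (l + j) i ** (\<Sum>k<l. ?R i k ** chi1 y k))))) =
      (\<Sum>a\<in>UNIV.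
        (\<Sum>j<m a. transpose (p_tilde_plus \<rho> l j x) ** E a ** p_minus \<rho> (l - 1) (m a - j - 1) y) -
        (\<Sum>j<n a. transpose (p_tilde_minus \<rho> (l - 1) (n a - j - 1) x) ** E a ** p_plus \<rho> l j y))"
      by (intro sum.cong refl arg_cong2[where f = "(-)"])
         (simp_all only: lessThan_iff p_plus_eq p_tilde_plus_eq p_minus_eq[OF assms(4) _ m]
            p_tilde_minus_eq[OF assms(4) _ n])
  qed (use moment_matrix_symmetry[OF assms(1,2)] multi_pow_mult_weight[OF assms(2)] n m
        in \<open>simp_all add: chi1_mult_multi_pow\<close>)
qed

end
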